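(* Let $M,N$ be topological manifolds (without boundary) of the same dimension. Let $h^\ast$ be a multiplicative cohomology theory on the homotopy category of pairs of spaces. For any surjective continuous map $f\colon M\to N$, we have $$\mathrm{nil}\left(\mathrm{Ker}\left(f^\ast\colon h^\ast(N)\to h^\ast(M)\right)\right)\leq\mathrm{IC}(f).$$
   Context: "Map" means continuous map. For a map $f\colon X\to Y$, the injective category number $\mathrm{IC}(f)$ is the smallest positive integer $\ell$ such that there are open subsets $U_1,\ldots,U_\ell\subset X$ with $X=U_1\cup\cdots\cup U_\ell$ and each restriction $f_{|U_j}\colon U_j\to Y$ injective; $\mathrm{IC}(f)=\infty$ if no such $\ell$ exists. A multiplicative cohomology theory $h^\ast$ on the homotopy category of pairs of spaces is a generalized cohomology theory (homotopy invariant, with long exact sequences of pairs and excision) that comes equipped with a relative cohomology product $\cup\colon h^\ast(X,A)\otimes h^\ast(X,B)\to h^\ast(X,A\cup B)$ whenever $A,B\subset X$ are excisive (in particular when $A,B$ are open in $X$); these products are compatible with the absolute product on $h^\ast(X)=h^\ast(X,\varnothing)$, which makes $h^\ast(X)$ a graded ring. For a subset $S$ of a ring $R$, the index of nilpotence is $\mathrm{nil}(S)=\min\{n\geq 1:\ \text{every product of } n \text{ elements in } S \text{ vanishes}\}$ (with value $\infty$ if no such $n$ exists). *)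

theory Defs
  imports "HOL-Analysis.Analysis" "HOL-Homology.Homology" "HOL-Algebra.AbelCoset" "HOL-Library.Extended_Nat"
begin

definition topological_manifold :: "nat \<Rightarrow> 'a topology \<Rightarrow> bool" where
  "topological_manifold d X \<longleftrightarrow>
     Hausdorff_space X \<and> second_countable X \<and>
     (\<forall>x \<in> topspace X. \<exists>U V. openin X U \<and> x \<in> U \<and> openin (Euclidean_space d) V \<and>
        subtopology X U homeomorphic_space subtopology (Euclidean_space d) V)"

definition IC :: "'a topology \<Rightarrow> ('a \<Rightarrow> 'b) \<Rightarrow> enat" where
  "IC X f = Inf {enat l | l. l \<ge> 1 \<and>
     (\<exists>U :: nat \<Rightarrow> 'a set. (\<forall>j \<in> {1..l}. openin X (U j) \<and> inj_on f (U j)) \<and>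
        topspace X = (\<Union>j \<in> {1..l}. U j))}"

definition nil :: "('r, 'm) ring_scheme \<Rightarrow> 'r set \<Rightarrow> enat" where
  "nil R S = Inf {enat n | n. n \<ge> 1 \<and>
     (\<forall>xs. length xs = n \<and> set xs \<subseteq> S \<longrightarrow> foldr (\<otimes>\<^bsub>R\<^esub>) xs \<one>\<^bsub>R\<^esub> = \<zero>\<^bsub>R\<^esub>)}"

definition pair_map ::
  "'a topology \<Rightarrow> 'a set \<Rightarrow> 'a topology \<Rightarrow> 'a set \<Rightarrow> ('a \<Rightarrow> 'a) \<Rightarrow> bool" where
  "pair_map X A Y B f \<longleftrightarrow>
     A \<subseteq> topspace X \<and> B \<subseteq> topspace Y \<and> continuous_map X Y f \<and> f ` A \<subseteq> B"

text \<open>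
  A generalized cohomology theory on the pairs of spaces whose points lie in \<^typ>\<open>'a\<close>;
  this collection of pairs is closed under passage to subspaces, the only construction on spaces
  that the axioms refer to. The abelian groups are written multiplicatively, as in the homology
  library. \<open>pull n X A Y B f\<close> is the map from \<open>H n Y B\<close> to \<open>H n X A\<close> induced by \<open>f\<close>; by the
  homotopy axiom it depends on \<open>f\<close> only through its restriction to \<open>topspace X\<close>.
\<close>

locale cohomology_theory =
  fixes H :: "int \<Rightarrow> 'a topology \<Rightarrow> 'a set \<Rightarrow> 'g monoid"
    and pull :: "int \<Rightarrow> 'a topology \<Rightarrow> 'a set \<Rightarrow> 'a topology \<Rightarrow> 'a set \<Rightarrow> ('a \<Rightarrow> 'a) \<Rightarrow> 'g \<Rightarrow> 'g"
    and delta :: "int \<Rightarrow> 'a topology \<Rightarrow> 'a set \<Rightarrow> 'g \<Rightarrow> 'g"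
  assumes comm_group: "A \<subseteq> topspace X \<Longrightarrow> comm_group (H n X A)"
    and pull_hom: "pair_map X A Y B f \<Longrightarrow> pull n X A Y B f \<in> hom (H n Y B) (H n X A)"
    and pull_id: "A \<subseteq> topspace X \<Longrightarrow> x \<in> carrier (H n X A) \<Longrightarrow> pull n X A X A id x = x"
    and pull_comp: "pair_map X A Y B f \<Longrightarrow> pair_map Y B Z C g \<Longrightarrow> z \<in> carrier (H n Z C) \<Longrightarrow>
           pull n X A Z C (g \<circ> f) z = pull n X A Y B f (pull n Y B Z C g z)"
    and homotopy: "A \<subseteq> topspace X \<Longrightarrow> B \<subseteq> topspace Y \<Longrightarrow>
           homotopic_with (\<lambda>k. k ` A \<subseteq> B) X Y f g \<Longrightarrow> y \<in> carrier (H n Y B) \<Longrightarrow>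
           pull n X A Y B f y = pull n X A Y B g y"
    and delta_hom: "A \<subseteq> topspace X \<Longrightarrow>
           delta n X A \<in> hom (H n (subtopology X A) {}) (H (n + 1) X A)"
    and delta_natural: "pair_map X A Y B f \<Longrightarrow> y \<in> carrier (H n (subtopology Y B) {}) \<Longrightarrow>
           delta n X A (pull n (subtopology X A) {} (subtopology Y B) {} f y)
             = pull (n + 1) X A Y B f (delta n Y B y)"
    and exactness: "A \<subseteq> topspace X \<Longrightarrow>
           exact_seq ([H (n + 1) X {}, H (n + 1) X A, H n (subtopology X A) {}, H n X {}, H n X A],
             [pull (n + 1) X {} X A id, delta n X A,
              pull n (subtopology X A) {} X {} id, pull n X {} X A id])"
    and excision: "A \<subseteq> topspace X \<Longrightarrow> U \<subseteq> A \<Longrightarrow> X closure_of U \<subseteq> X interior_of A \<Longrightarrow>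
           pull n (subtopology X (topspace X - U)) (A - U) X A id
             \<in> iso (H n X A) (H n (subtopology X (topspace X - U)) (A - U))"

text \<open>
  \<open>A\<close> and \<open>B\<close> are excisive in \<open>X\<close> when their interiors relative to \<open>A \<union> B\<close> cover \<open>A \<union> B\<close>; this
  holds when both are open. By excision such couples are also excisive in the sense that the
  inclusion \<open>(B, A \<inter> B) \<rightarrow> (A \<union> B, A)\<close> induces isomorphisms for the theory at hand, so demanding
  products only for them is the weaker requirement.
\<close>

definition excisive :: "'a topology \<Rightarrow> 'a set \<Rightarrow> 'a set \<Rightarrow> bool" where
  "excisive X A B \<longleftrightarrow> A \<subseteq> topspace X \<and> B \<subseteq> topspace X \<and>
     subtopology X (A \<union> B) interior_of A \<union> subtopology X (A \<union> B) interior_of B = A \<union> B"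

text \<open>
  \<open>cup p q X A B\<close> is the product of degree \<open>p\<close> classes of \<open>(X, A)\<close> with degree \<open>q\<close> classes of
  \<open>(X, B)\<close>. Taking \<open>f = id\<close> in \<open>cup_natural\<close> gives its compatibility with the absolute product
  \<open>cup p q X {} {}\<close>. Graded commutativity and compatibility with \<open>delta\<close> are not assumed.
\<close>

locale multiplicative_cohomology_theory = cohomology_theory H pull delta
  for H :: "int \<Rightarrow> 'a topology \<Rightarrow> 'a set \<Rightarrow> 'g monoid"
    and pull :: "int \<Rightarrow> 'a topology \<Rightarrow> 'a set \<Rightarrow> 'a topology \<Rightarrow> 'a set \<Rightarrow> ('a \<Rightarrow> 'a) \<Rightarrow> 'g \<Rightarrow> 'g"
    and delta :: "int \<Rightarrow> 'a topology \<Rightarrow> 'a set \<Rightarrow> 'g \<Rightarrow> 'g" +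
  fixes cup :: "int \<Rightarrow> int \<Rightarrow> 'a topology \<Rightarrow> 'a set \<Rightarrow> 'a set \<Rightarrow> 'g \<Rightarrow> 'g \<Rightarrow> 'g"
    and unit :: "'a topology \<Rightarrow> 'g"
  assumes cup_hom_left: "excisive X A B \<Longrightarrow> y \<in> carrier (H q X B) \<Longrightarrow>
           (\<lambda>x. cup p q X A B x y) \<in> hom (H p X A) (H (p + q) X (A \<union> B))"
    and cup_hom_right: "excisive X A B \<Longrightarrow> x \<in> carrier (H p X A) \<Longrightarrow>
           (\<lambda>y. cup p q X A B x y) \<in> hom (H q X B) (H (p + q) X (A \<union> B))"
    and cup_natural: "excisive X A B \<Longrightarrow> excisive Y C D \<Longrightarrow>
           pair_map X A Y C f \<Longrightarrow> pair_map X B Y D f \<Longrightarrow>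
           x \<in> carrier (H p Y C) \<Longrightarrow> y \<in> carrier (H q Y D) \<Longrightarrow>
           pull (p + q) X (A \<union> B) Y (C \<union> D) f (cup p q Y C D x y)
             = cup p q X A B (pull p X A Y C f x) (pull q X B Y D f y)"
    and cup_assoc: "x \<in> carrier (H p X {}) \<Longrightarrow> y \<in> carrier (H q X {}) \<Longrightarrow>
           z \<in> carrier (H r X {}) \<Longrightarrow>
           cup (p + q) r X {} {} (cup p q X {} {} x y) z
             = cup p (q + r) X {} {} x (cup q r X {} {} y z)"
    and unit_closed: "unit X \<in> carrier (H 0 X {})"
    and unit_left: "x \<in> carrier (H p X {}) \<Longrightarrow> cup 0 p X {} {} (unit X) x = x"
    and unit_right: "x \<in> carrier (H p X {}) \<Longrightarrow> cup p 0 X {} {} x (unit X) = x"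
    and unit_natural: "continuous_map X Y f \<Longrightarrow> pull 0 X {} Y {} f (unit Y) = unit X"

text \<open>
  The graded ring \<open>h\<^sup>*(X)\<close>, the direct sum of the groups \<open>H n X {}\<close>. The product is the
  convolution of homogeneous components; it ranges over the support of the left factor since
  \<^const>\<open>finprod\<close> over an infinite index set is trivial.
\<close>

definition cohomology_ring ::
  "(int \<Rightarrow> 'a topology \<Rightarrow> 'a set \<Rightarrow> 'g monoid) \<Rightarrow>
   (int \<Rightarrow> int \<Rightarrow> 'a topology \<Rightarrow> 'a set \<Rightarrow> 'a set \<Rightarrow> 'g \<Rightarrow> 'g \<Rightarrow> 'g) \<Rightarrow>
   ('a topology \<Rightarrow> 'g) \<Rightarrow> 'a topology \<Rightarrow> (int \<Rightarrow> 'g) ring" where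
  "cohomology_ring H cup unit X =
     \<lparr>carrier = carrier (sum_group UNIV (\<lambda>n. H n X {})),
      mult = (\<lambda>a b n. finprod (H n X {}) (\<lambda>p. cup p (n - p) X {} {} (a p) (b (n - p)))
                        {p. a p \<noteq> \<one>\<^bsub>H p X {}\<^esub>}),
      one = (\<lambda>n. if n = 0 then unit X else \<one>\<^bsub>H n X {}\<^esub>),
      zero = \<one>\<^bsub>sum_group UNIV (\<lambda>n. H n X {})\<^esub>,
      add = (\<otimes>\<^bsub>sum_group UNIV (\<lambda>n. H n X {})\<^esub>)\<rparr>"

definition cohomology_map ::
  "(int \<Rightarrow> 'a topology \<Rightarrow> 'a set \<Rightarrow> 'a topology \<Rightarrow> 'a set \<Rightarrow> ('a \<Rightarrow> 'a) \<Rightarrow> 'g \<Rightarrow> 'g) \<Rightarrow>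
   'a topology \<Rightarrow> 'a topology \<Rightarrow> ('a \<Rightarrow> 'a) \<Rightarrow> (int \<Rightarrow> 'g) \<Rightarrow> int \<Rightarrow> 'g" where
  "cohomology_map pull X Y f a = (\<lambda>n. pull n X {} Y {} f (a n))"

end

theory Submission
  imports Defs
begin

text \<open>
  By invariance of domain, \<open>f\<close> restricts to a homeomorphism from each injective open set \<open>U\<^sub>j\<close>
  onto an open set \<open>V\<^sub>j \<subseteq> N\<close>, so a class in the kernel of \<open>f\<^sup>*\<close> vanishes on every \<open>V\<^sub>j\<close> and lifts
  to \<open>h\<^sup>*(N, V\<^sub>j)\<close>. A product of one such class for each \<open>j\<close> lifts to \<open>h\<^sup>*(N, \<Union>\<^sub>j V\<^sub>j)\<close>, which is
  \<open>h\<^sup>*(N, N) = 0\<close> because \<open>f\<close> is surjective.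
\<close>

text \<open>Charts around a point and its image turn the map into a continuous injection of an open
  subset of Euclidean space into Euclidean space of the same dimension, where Brouwer's theorem
  applies.\<close>

lemma invariance_of_domain_manifold:
  assumes M: "topological_manifold d M" and N: "topological_manifold d N"
    and f: "continuous_map M N f" and U: "openin M U" and inj: "inj_on f U"
  shows "openin N (f ` U)"
proof (subst openin_subopen, intro ballI)
  fix y assume "y \<in> f ` U"
  then obtain x where x: "x \<in> U" "y = f x" by blast
  have xM: "x \<in> topspace M" using openin_subset[OF U] x by blast
  have yN: "y \<in> topspace N" using x xM f by (auto simp: continuous_map_def Pi_iff)
  obtain A B \<phi> \<phi>' where A: "openin M A" "x \<in> A" and B: "openin (Euclidean_space d) B"
    and \<phi>: "homeomorphic_maps (subtopology M A) (subtopology (Euclidean_space d) B) \<phi> \<phi>'"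
    using M xM unfolding topological_manifold_def homeomorphic_space_def by metis
  obtain C D \<psi> \<psi>' where C: "openin N C" "y \<in> C" and D: "openin (Euclidean_space d) D"
    and \<psi>: "homeomorphic_maps (subtopology N C) (subtopology (Euclidean_space d) D) \<psi> \<psi>'"
    using N yN unfolding topological_manifold_def homeomorphic_space_def by metis
  \<comment> \<open>Shrinking to \<open>W\<close> keeps the source inside the chart
    \<open>A\<close>, the image inside the chart \<open>C\<close>, and \<open>f\<close>
    injective.\<close>
  define W where "W = {w \<in> topspace M. f w \<in> C} \<inter> A \<inter> U"
  have W: "openin M W"
    unfolding W_def by (intro openin_Int openin_continuous_map_preimage[OF f] C A U)
  have WM: "W \<subseteq> topspace M" "W \<subseteq> A" "W \<subseteq> U" and fW: "f ` W \<subseteq> C" "f ` W \<subseteq> topspace N"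
    using f by (auto simp: W_def continuous_map_def)
  have \<phi>_inv: "\<phi>' (\<phi> w) = w" if "w \<in> W" for w
    using \<phi> that WM by (auto simp: homeomorphic_maps_def)
  have \<psi>_inv: "\<psi>' (\<psi> z) = z" if "z \<in> f ` W" for z
    using \<psi> that fW by (auto simp: homeomorphic_maps_def)
  have "openin (subtopology M A) W"
    using W WM A by (simp add: openin_open_subtopology)
  then have "openin (subtopology (Euclidean_space d) B) (\<phi> ` W)"
    using \<phi> homeomorphic_map_openness_eq homeomorphic_maps_map by blast
  then have W': "openin (Euclidean_space d) (\<phi> ` W)" "\<phi> ` W \<subseteq> B"
    using B by (auto simp: openin_open_subtopology)
  have c1: "continuous_map (subtopology (Euclidean_space d) (\<phi> ` W)) (subtopology M W) \<phi>'"
  proof -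
    have "continuous_map (subtopology (Euclidean_space d) (\<phi> ` W)) M \<phi>'"
      using \<phi> W'(2) unfolding homeomorphic_maps_def
      by (meson continuous_map_from_subtopology_mono continuous_map_into_fulltopology)
    then show ?thesis
      using \<phi>_inv by (auto simp: continuous_map_in_subtopology)
  qed
  have c2: "continuous_map (subtopology M W) (subtopology N C) f"
    using f fW by (auto simp: continuous_map_in_subtopology continuous_map_from_subtopology)
  have c3: "continuous_map (subtopology N C) (Euclidean_space d) \<psi>"
    using \<psi> unfolding homeomorphic_maps_def by (meson continuous_map_into_fulltopology)
  \<comment> \<open>The composite is \<open>f\<close> written in the two charts.\<close>
  have "openin (Euclidean_space d) ((\<psi> \<circ> (f \<circ> \<phi>')) ` (\<phi> ` W))"
  proof (rule invariance_of_domain_Euclidean_space[OF W'(1)])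
    show "continuous_map (subtopology (Euclidean_space d) (\<phi> ` W)) (Euclidean_space d) (\<psi> \<circ> (f \<circ> \<phi>'))"
      by (intro continuous_map_compose[OF _ c3] continuous_map_compose[OF c1 c2])
    show "inj_on (\<psi> \<circ> (f \<circ> \<phi>')) (\<phi> ` W)"
    proof (rule inj_onI, elim imageE, clarify)
      fix v w assume vw: "v \<in> W" "w \<in> W" and "(\<psi> \<circ> (f \<circ> \<phi>')) (\<phi> v) = (\<psi> \<circ> (f \<circ> \<phi>')) (\<phi> w)"
      then have "\<psi> (f v) = \<psi> (f w)" by (simp add: \<phi>_inv)
      then have "f v = f w" using \<psi>_inv vw by (metis imageI)
      then show "\<phi> v = \<phi> w" using inj vw WM by (metis inj_onD subsetD)
    qed
  qed
  moreover have "(\<psi> \<circ> (f \<circ> \<phi>')) ` (\<phi> ` W) = \<psi> ` f ` W"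
    by (simp add: image_image \<phi>_inv cong: image_cong)
  ultimately have "openin (Euclidean_space d) (\<psi> ` f ` W)" by simp
  \<comment> \<open>Openness passes from Euclidean space to \<open>D\<close>, back along
    \<open>\<psi>\<close> to \<open>C\<close>, and on to \<open>N\<close> because \<open>C\<close>
    is open.\<close>
  moreover have "\<psi> ` f ` W \<subseteq> D"
    using \<psi> fW by (auto simp: homeomorphic_maps_def continuous_map_def)
  ultimately have "openin (subtopology (Euclidean_space d) D) (\<psi> ` f ` W)"
    using D by (simp add: openin_open_subtopology)
  moreover have "homeomorphic_map (subtopology N C) (subtopology (Euclidean_space d) D) \<psi>"
    using \<psi> homeomorphic_maps_map by blast
  ultimately have "openin (subtopology N C) (f ` W)"
    using homeomorphic_map_openness[of _ _ \<psi> "f ` W"] fW by simp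
  then have "openin N (f ` W)" using C openin_open_subtopology by blast
  moreover have "y \<in> f ` W" using x xM A C by (auto simp: W_def)
  ultimately show "\<exists>T. openin N T \<and> y \<in> T \<and> T \<subseteq> f ` U" using WM by blast
qed

text \<open>The preimage of an open \<open>W\<close> under the inverse is the image of
  \<open>U \<inter> W\<close> under \<open>f\<close>, which is open by \<open>opn\<close>.\<close>

lemma continuous_inverse_of_open_injection:
  assumes f: "continuous_map X Y f" and inj: "inj_on f U" and U: "openin X U"
    and opn: "\<And>W. openin X W \<Longrightarrow> W \<subseteq> U \<Longrightarrow> openin Y (f ` W)"
  shows "continuous_map (subtopology Y (f ` U)) X (inv_into U f)"
proof -
  have UX: "U \<subseteq> topspace X" by (rule openin_subset[OF U])
  have "openin (subtopology Y (f ` U)) {y \<in> topspace (subtopology Y (f ` U)). inv_into U f y \<in> W}"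
    if W: "openin X W" for W
  proof -
    have "{y \<in> topspace (subtopology Y (f ` U)). inv_into U f y \<in> W} = f ` (U \<inter> W)"
      using inj openin_subset[OF opn[OF U order_refl]] by (auto simp: inv_into_f_f)
    moreover have "openin Y (f ` (U \<inter> W))" by (intro opn openin_Int U W) blast
    ultimately show ?thesis by (simp add: openin_open_subtopology opn[OF U] image_mono)
  qed
  moreover have "inv_into U f ` (topspace Y \<inter> f ` U) \<subseteq> topspace X"
    using UX inj by (auto simp: inv_into_f_f)
  ultimately show ?thesis by (auto simp: continuous_map_def)
qed

text \<open>This keeps convolution products inside a subgroup. Infinite \<open>I\<close> is
  harmless: there \<open>finprod\<close> defaults to the unit, which lies in
  \<open>K\<close>.\<close>

lemma (in comm_monoid) finprod_in_submonoid:
  assumes K: "submonoid K G" and f: "\<And>i. i \<in> I \<Longrightarrow> f i \<in> K"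
  shows "finprod G f I \<in> K"
  using f
proof (induction I rule: infinite_finite_induct)
  case (insert i I)
  then have "finprod G f (insert i I) = f i \<otimes> finprod G f I"
    using submonoid.subset[OF K] by (intro finprod_insert) auto
  then show ?case using insert submonoid.m_closed[OF K] by auto
qed (auto simp: submonoid.one_closed[OF K])

lemma excisive_open:
  assumes "openin X A" "openin X B"
  shows "excisive X A B"
proof -
  have "subtopology X (A \<union> B) interior_of A = A" "subtopology X (A \<union> B) interior_of B = B"
    using assms by (auto simp: interior_of_eq openin_open_subtopology openin_Un)
  then show ?thesis using assms[THEN openin_subset] by (auto simp: excisive_def)
qed

context cohomology_theory
begin

text \<open>An image rather than the kernel of restriction to \<open>A\<close>, since relative
  products act on actual preimages in \<open>H n X A\<close>.\<close>

definition lifts :: "int \<Rightarrow> 'a topology \<Rightarrow> 'a set \<Rightarrow> 'g set" where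
  "lifts n X A = pull n X {} X A id ` carrier (H n X A)"

lemma pair_map_id: "A \<subseteq> B \<Longrightarrow> B \<subseteq> topspace X \<Longrightarrow> pair_map X A X B id"
  by (auto simp: pair_map_def)

lemma lifts_empty [simp]: "lifts n X {} = carrier (H n X {})"
  by (auto simp: lifts_def pull_id image_iff)

lemma pull_group_hom:
  assumes "pair_map X A Y B f"
  shows "group_hom (H n Y B) (H n X A) (pull n X A Y B f)"
  using assms pull_hom comm_group
  by (auto simp: group_hom_def group_hom_axioms_def pair_map_def comm_group_def)

lemma subgroup_lifts:
  assumes "A \<subseteq> topspace X"
  shows "subgroup (lifts n X A) (H n X {})"
  unfolding lifts_def
  by (intro group_hom.img_is_subgroup pull_group_hom pair_map_id assms) auto

lemma lifts_eq_kernel: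
  assumes "A \<subseteq> topspace X"
  shows "lifts n X A = kernel (H n X {}) (H n (subtopology X A) {}) (pull n (subtopology X A) {} X {} id)"
  \<comment> \<open>The lists run against the arrows, so index 2 selects exactness at
    \<open>H n X {}\<close>.\<close>
  using exact_seq_imp_exact_hom_arbitrary[OF exactness[OF assms, of n], of 2]
  by (simp add: lifts_def numeral_eq_Suc)

text \<open>Restriction to the whole space is the identity, so its kernel is trivial. This serves as
  the vanishing of the cohomology of \<open>(X, X)\<close>.\<close>

lemma lifts_topspace: "lifts n X (topspace X) = {\<one>\<^bsub>H n X {}\<^esub>}"
proof -
  interpret comm_group "H n X {}" by (rule comm_group) simp
  show ?thesis
    by (auto simp: lifts_eq_kernel kernel_def pull_id)
qed

lemma pull_cong:
  assumes "continuous_map X Y f" "\<And>x. x \<in> topspace X \<Longrightarrow> f x = g x" "y \<in> carrier (H n Y {})"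
  shows "pull n X {} Y {} f y = pull n X {} Y {} g y"
  using assms by (intro homotopy homotopic_with_equal) auto

text \<open>The inclusion of the image of \<open>U\<close> factors as \<open>f\<close> after the
  local inverse, so restricting \<open>y\<close> to that image passes through its pullback along
  \<open>f\<close>, which is trivial. Exactness then gives the lift.\<close>

lemma kernel_lifts_to_injective_image:
  assumes f: "continuous_map X Y f" and inj: "inj_on f U" and U: "openin X U"
    and opn: "\<And>W. openin X W \<Longrightarrow> W \<subseteq> U \<Longrightarrow> openin Y (f ` W)"
    and y: "y \<in> carrier (H n Y {})" and fy: "pull n X {} Y {} f y = \<one>\<^bsub>H n X {}\<^esub>"
  shows "y \<in> lifts n Y (f ` U)"
proof -
  let ?V = "subtopology Y (f ` U)" and ?g = "inv_into U f"
  have V: "f ` U \<subseteq> topspace Y" using opn[OF U] openin_subset by blast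
  have g: "pair_map ?V {} X {} ?g"
    using continuous_inverse_of_open_injection[OF f inj U opn] by (simp add: pair_map_def)
  have "pull n ?V {} Y {} id y = pull n ?V {} Y {} (f \<circ> ?g) y"
    by (intro pull_cong y) (auto simp: f_inv_into_f continuous_map_from_subtopology)
  also have "\<dots> = pull n ?V {} X {} ?g (pull n X {} Y {} f y)"
    using f by (intro pull_comp g y) (simp add: pair_map_def)
  also have "\<dots> = \<one>\<^bsub>H n ?V {}\<^esub>"
    unfolding fy by (rule group_hom.hom_one[OF pull_group_hom[OF g]])
  finally show ?thesis using V y by (simp add: lifts_eq_kernel kernel_def)
qed

end

context multiplicative_cohomology_theory
begin

text \<open>The relative product of preimages lives on \<open>(X, A \<union> B)\<close>; naturality
  under the identity, from the empty pair, sends it to the absolute product.\<close>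

lemma cup_lifts:
  assumes AB: "openin X A" "openin X B" and x: "x \<in> lifts p X A" and y: "y \<in> lifts q X B"
  shows "cup p q X {} {} x y \<in> lifts (p + q) X (A \<union> B)"
proof -
  obtain u v where u: "u \<in> carrier (H p X A)" "x = pull p X {} X A id u"
    and v: "v \<in> carrier (H q X B)" "y = pull q X {} X B id v"
    using x y by (auto simp: lifts_def)
  have sub: "A \<subseteq> topspace X" "B \<subseteq> topspace X" using AB openin_subset by auto
  have ex: "excisive X A B" using AB by (rule excisive_open)
  have "pull (p + q) X ({} \<union> {}) X (A \<union> B) id (cup p q X A B u v) = cup p q X {} {} x y"
    unfolding u v using sub
    by (intro cup_natural excisive_open ex u v pair_map_id) auto
  moreover have "cup p q X A B u v \<in> carrier (H (p + q) X (A \<union> B))"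
    using hom_in_carrier[OF cup_hom_left[OF ex v(1)] u(1)] .
  ultimately show ?thesis unfolding lifts_def by (metis imageI Un_empty_left)
qed

text \<open>For inhomogeneous classes, each term of the convolution in degree \<open>n\<close>
  lifts, and the lifts form a subgroup.\<close>

lemma mult_lifts:
  assumes AB: "openin X A" "openin X B"
    and a: "\<And>p. a p \<in> lifts p X A" and b: "\<And>q. b q \<in> lifts q X B"
  shows "(a \<otimes>\<^bsub>cohomology_ring H cup unit X\<^esub> b) n \<in> lifts n X (A \<union> B)"
proof -
  interpret comm_group "H n X {}" by (rule comm_group) simp
  have "cup p (n - p) X {} {} (a p) (b (n - p)) \<in> lifts n X (A \<union> B)" for p
    using cup_lifts[OF AB a[of p] b[of "n - p"]] by simp
  moreover have "submonoid (lifts n X (A \<union> B)) (H n X {})"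
    using AB openin_subset by (intro subgroup.subgroup_is_submonoid subgroup_lifts) blast
  ultimately show ?thesis
    by (simp add: cohomology_ring_def finprod_in_submonoid)
qed

lemma foldr_mult_lifts:
  assumes "list_all2 (\<lambda>a A. openin X A \<and> (\<forall>n. a n \<in> lifts n X A)) as As"
  shows "foldr (\<otimes>\<^bsub>cohomology_ring H cup unit X\<^esub>) as \<one>\<^bsub>cohomology_ring H cup unit X\<^esub> n
           \<in> lifts n X (\<Union>(set As))"
  using assms
proof (induction arbitrary: n rule: list_all2_induct)
  case Nil
  \<comment> \<open>For the empty product the union of open sets is empty, and every absolute class
    lifts there; only closure of the unit components remains.\<close>
  have "\<one>\<^bsub>H n X {}\<^esub> \<in> carrier (H n X {})"
    using comm_group[of "{}" X n] by (simp add: comm_group_def group.is_monoid monoid.one_closed)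
  then show ?case using unit_closed by (simp add: cohomology_ring_def)
next
  case (Cons a as A As)
  have "openin X (\<Union>(set As))"
    using Cons.hyps(2) by (intro openin_Union) (auto simp: list_all2_conv_all_nth in_set_conv_nth)
  then show ?case using mult_lifts[of X A] Cons by simp
qed

end

theorem theorem2p16:
  fixes M N :: "'a topology" and d :: nat and f :: "'a \<Rightarrow> 'a"
    and H :: "int \<Rightarrow> 'a topology \<Rightarrow> 'a set \<Rightarrow> 'g monoid"
    and pull :: "int \<Rightarrow> 'a topology \<Rightarrow> 'a set \<Rightarrow> 'a topology \<Rightarrow> 'a set \<Rightarrow> ('a \<Rightarrow> 'a) \<Rightarrow> 'g \<Rightarrow> 'g"
    and delta :: "int \<Rightarrow> 'a topology \<Rightarrow> 'a set \<Rightarrow> 'g \<Rightarrow> 'g"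
    and cup :: "int \<Rightarrow> int \<Rightarrow> 'a topology \<Rightarrow> 'a set \<Rightarrow> 'a set \<Rightarrow> 'g \<Rightarrow> 'g \<Rightarrow> 'g"
    and unit :: "'a topology \<Rightarrow> 'g"
  assumes "topological_manifold d M" and "topological_manifold d N"
    and "multiplicative_cohomology_theory H pull delta cup unit"
    and "continuous_map M N f" and "f ` topspace M = topspace N"
  shows "nil (cohomology_ring H cup unit N)
           (a_kernel (cohomology_ring H cup unit N) (cohomology_ring H cup unit M)
              (cohomology_map pull M N f))
         \<le> IC M f"
proof -
  interpret multiplicative_cohomology_theory H pull delta cup unit by fact
  let ?R = "cohomology_ring H cup unit N"
  let ?K = "a_kernel ?R (cohomology_ring H cup unit M) (cohomology_map pull M N f)"
  have group_N: "group (H n N {})" for n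
    using comm_group[of "{}" N n] by (simp add: comm_group_def)
  have K: "a n \<in> carrier (H n N {}) \<and> pull n M {} N {} f (a n) = \<one>\<^bsub>H n M {}\<^esub>" if "a \<in> ?K" for a n
    using that group_N
    by (auto simp: a_kernel_def' cohomology_ring_def cohomology_map_def carrier_sum_group dest: fun_cong)
  have nilpotent: "foldr (\<otimes>\<^bsub>?R\<^esub>) as \<one>\<^bsub>?R\<^esub> = \<zero>\<^bsub>?R\<^esub>"
    if U: "\<forall>j\<in>{1..l}. openin M (U j) \<and> inj_on f (U j)" "topspace M = (\<Union>j\<in>{1..l}. U j)"
      and as: "length as = l" "set as \<subseteq> ?K" for l U as
  proof
    fix n
    \<comment> \<open>Injectivity is inherited by \<open>W\<close>, so invariance of domain applies
      to every open subset of \<open>U j\<close>.\<close>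
    have opn: "openin N (f ` W)" if "openin M W" "W \<subseteq> U j" "j \<in> {1..l}" for W j
      using that U(1) inj_on_subset by (blast intro: invariance_of_domain_manifold[OF assms(1,2,4)])
    \<comment> \<open>The cover is indexed from 1 and lists from 0, so entry \<open>i\<close> comes
      from \<open>U (Suc i)\<close>.\<close>
    let ?Vs = "map (\<lambda>j. f ` U j) [1..<Suc l]"
    have "list_all2 (\<lambda>a A. openin N A \<and> (\<forall>n. a n \<in> lifts n N A)) as ?Vs"
    proof (rule list_all2_all_nthI)
      show "length as = length ?Vs" using as by simp
    next
      fix i assume i: "i < length as"
      then have j: "Suc i \<in> {1..l}" and V: "?Vs ! i = f ` U (Suc i)"
        using as by (auto simp del: upt_Suc)
      have "as ! i \<in> ?K" using i as nth_mem by blast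
      then have "(as ! i) n \<in> lifts n N (f ` U (Suc i))" for n
        using K U(1) j opn by (intro kernel_lifts_to_injective_image[OF assms(4)]) auto
      then show "openin N (?Vs ! i) \<and> (\<forall>n. (as ! i) n \<in> lifts n N (?Vs ! i))"
        unfolding V using opn[OF _ order_refl j] U(1) j by blast
    qed
    \<comment> \<open>Surjectivity of \<open>f\<close> enters here: the images of a cover of
      \<open>M\<close> cover \<open>N\<close>.\<close>
    moreover have "\<Union>(set ?Vs) = topspace N"
      using assms(5) U(2) by (simp add: atLeastLessThanSuc_atLeastAtMost image_UN del: upt_Suc)
    ultimately have "foldr (\<otimes>\<^bsub>?R\<^esub>) as \<one>\<^bsub>?R\<^esub> n \<in> lifts n N (topspace N)"
      using foldr_mult_lifts[of N as ?Vs n] by (simp only:)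
    then show "foldr (\<otimes>\<^bsub>?R\<^esub>) as \<one>\<^bsub>?R\<^esub> n = \<zero>\<^bsub>?R\<^esub> n"
      by (simp add: lifts_topspace cohomology_ring_def)
  qed
  \<comment> \<open>Every cover size admissible for \<open>IC\<close> is an admissible nilpotence
    exponent, so the infima compare; if no finite cover exists, the right side is the infimum of the
    empty set, namely infinity.\<close>
  show ?thesis
    unfolding nil_def IC_def
  proof (rule Inf_superset_mono, clarify)
    fix l :: nat and U
    assume "1 \<le> l" "\<forall>j\<in>{1..l}. openin M (U j) \<and> inj_on f (U j)" "topspace M = (\<Union>j\<in>{1..l}. U j)"
    then show "\<exists>n. enat l = enat n \<and> 1 \<le> n \<and>
        (\<forall>xs. length xs = n \<and> set xs \<subseteq> ?K \<longrightarrow> foldr (\<otimes>\<^bsub>?R\<^esub>) xs \<one>\<^bsub>?R\<^esub> = \<zero>\<^bsub>?R\<^esub>)"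
      using nilpotent[of l U] by (intro exI[of _ l] conjI allI impI) auto
  qed
qed

end
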